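(* Let $x,y$ be positive integers with $x<y$ and $\gcd(x,y)=1$. Then the period $p(x,y)$ of a periodic orbit on the $60^\circ$-$90^\circ$-$120^\circ$-kite with initial angle $\Theta=\arctan\left(\frac{y}{x}\sqrt{3}\right)$ is $$p(x,y)=\begin{cases} 3y+\frac{x}{3} & \text{if } x\equiv 0 \bmod 3 \text{ and } x\equiv y \bmod 2,\\ 6y+\frac{2x}{3} & \text{if } x\equiv 0 \bmod 3 \text{ and } x\not\equiv y \bmod 2,\\ 3y+\frac{x+2}{3} \text{ or } 6y+\frac{2x-2}{3} & \text{if } x\equiv 1 \bmod 3 \text{ and } x\equiv y \bmod 2,\\ 6y+\frac{2x-2}{3} \text{ or } 12y+\frac{4x+2}{3} & \text{if } x\equiv 1 \bmod 3 \text{ and } x\not\equiv y \bmod 2,\\ 3y+\frac{x-2}{3} \text{ or } 6y+\frac{2x+2}{3} & \text{if } x\equiv 2 \bmod 3 \text{ and } x\equiv y \bmod 2,\\ 6y+\frac{2x+2}{3} \text{ or } 12y+\frac{4x-2}{3} & \text{if } x\equiv 2 \bmod 3 \text{ and } x\not\equiv y \bmod 2. \end{cases}$$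
   Context: Billiards: a point particle moves with unit speed along straight lines in a polygon $G$, reflecting elastically at the edges (angle of incidence equals angle of reflection). Its path is its orbit. An orbit that reaches a vertex terminates and is singular; otherwise it is non-singular. A non-singular orbit is periodic if it begins and ends at the same point and the particle retraces its orbit when allowed to continue. A periodic orbit is primitive if it is traversed exactly once. The period of a periodic orbit is the number of times the particle strikes $\partial G$ while traversing a primitive sub-orbit. Kite: let $\triangle ABC$ be isosceles with $\angle B=120^\circ$, base $\overline{AC}$ horizontal with $A$ to the left of $C$, and apex $B$ above $\overline{AC}$; let $O$ be the midpoint of $\overline{AC}$. The $60^\circ$-$90^\circ$-$120^\circ$-kite is $\Box AOBD$, where $D$ is the reflection of $O$ in the line $AB$ (interior angles $60^\circ$ at $A$, $90^\circ$ at $O$ and $D$, $120^\circ$ at $B$). Orbits start at a point $P$ in the interior of the horizontal edge $\overline{AO}$ and initially move into the kite; the initial angle $\Theta$ is the angle between the ray from $P$ towards $O$ and the initial direction of motion. *)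

theory Defs
  imports "HOL-Analysis.Analysis" "HOL-Number_Theory.Cong"
begin

definition angle_between :: "'a::real_inner \<Rightarrow> 'a \<Rightarrow> real" where
  "angle_between u v = arccos ((u \<bullet> v) / (norm u * norm v))"

text \<open>Linear reflection of the vector \<open>v\<close> in the line spanned by \<open>d\<close>.\<close>
definition reflect_vector :: "'a::real_inner \<Rightarrow> 'a \<Rightarrow> 'a" where
  "reflect_vector d v = (2 * (v \<bullet> d) / (d \<bullet> d)) *\<^sub>R d - v"

text \<open>Reflection of the point \<open>p\<close> in the affine line through \<open>a\<close> and \<open>b\<close>.\<close>
definition reflect_point :: "'a::real_inner \<Rightarrow> 'a \<Rightarrow> 'a \<Rightarrow> 'a" where
  "reflect_point a b p = a + reflect_vector (b - a) (p - a)"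

text \<open>A polygon is given by the cyclic list of its vertices; the plane is the type of complex
  numbers.\<close>
definition polygon_edges :: "complex list \<Rightarrow> (complex \<times> complex) set" where
  "polygon_edges vs = {(vs ! i, vs ! (Suc i mod length vs)) | i. i < length vs}"

definition polygon_boundary :: "complex list \<Rightarrow> complex set" where
  "polygon_boundary vs = (\<Union>(a, b)\<in>polygon_edges vs. closed_segment a b)"

definition polygon_interior :: "complex list \<Rightarrow> complex set" where
  "polygon_interior vs = inside (polygon_boundary vs)"

text \<open>A non-singular orbit that starts on the boundary is represented by its starting point
  \<open>p 0\<close> and the points \<open>p 1, p 2, \<dots>\<close> at which it successively strikes the boundary. The velocity
  on the leg from \<open>p k\<close> to \<open>p (Suc k)\<close> is the unit vector \<open>sgn (p (Suc k) - p k)\<close>. Open edges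
  contain no vertex, so singular orbits are excluded.\<close>
definition nonsingular_orbit :: "complex list \<Rightarrow> (nat \<Rightarrow> complex) \<Rightarrow> bool" where
  "nonsingular_orbit vs p \<longleftrightarrow>
     (\<exists>(a, b)\<in>polygon_edges vs. p 0 \<in> open_segment a b) \<and>
     (\<forall>k. p (Suc k) \<noteq> p k \<and> open_segment (p k) (p (Suc k)) \<subseteq> polygon_interior vs) \<and>
     (\<forall>k. \<exists>(a, b)\<in>polygon_edges vs. p (Suc k) \<in> open_segment a b \<and>
        sgn (p (Suc (Suc k)) - p (Suc k)) = reflect_vector (b - a) (sgn (p (Suc k) - p k)))"

text \<open>After its \<open>n\<close>-th strike the orbit is back at its starting point and from then on it retraces
  itself.\<close>
definition retraces_after :: "(nat \<Rightarrow> complex) \<Rightarrow> nat \<Rightarrow> bool" where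
  "retraces_after p n \<longleftrightarrow> 0 < n \<and> (\<forall>k. p (n + k) = p k)"

definition periodic_orbit :: "complex list \<Rightarrow> (nat \<Rightarrow> complex) \<Rightarrow> bool" where
  "periodic_orbit vs p \<longleftrightarrow> nonsingular_orbit vs p \<and> (\<exists>n. retraces_after p n)"

text \<open>The primitive sub-orbit runs through \<open>p 0, \<dots>, p n\<close> with \<open>n\<close> least possible; it strikes the
  boundary at \<open>p 1, \<dots>, p n\<close>, the common start and end point \<open>p n = p 0\<close> being counted once.\<close>
definition orbit_period :: "(nat \<Rightarrow> complex) \<Rightarrow> nat" where
  "orbit_period p = (LEAST n. retraces_after p n)"

text \<open>The name \<open>M\<close> replaces the traditional \<open>O\<close> (midpoint of the base \<open>AC\<close>), which is reserved
  syntax for relation composition. The size and position of the triangle are arbitrary.\<close>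
definition kite_60_90_120 :: "complex \<Rightarrow> complex \<Rightarrow> complex \<Rightarrow> complex \<Rightarrow> bool" where
  "kite_60_90_120 A M B D \<longleftrightarrow>
     (\<exists>C. Im A = Im C \<and> Re A < Re C \<and> Im A < Im B \<and>
          dist A B = dist C B \<and> angle_between (A - B) (C - B) = 2 * pi / 3 \<and>
          M = midpoint A C \<and> D = reflect_point A B M)"

end

theory Submission imports Defs begin

text \<open>Reflecting the kite in its edges tiles the plane, and unfolding turns an orbit into a straight line.
The tiles are regular hexagons centred at the points of a triangular lattice (the images of \<open>A\<close>), each
cut into six kites by the segments from its centre to the midpoints of its sides. Let \<open>v\<close> be the
primitive lattice vector in the direction of the line. Up to the mirror symmetry of the kite in \<open>AB\<close>
the picture repeats after the translation by \<open>v\<close>, so the orbit repeats, up to that symmetry, after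
the number \<open>N\<close> of tiles which the line meets per translation. Every strike reverses the orientation
of the tile. Hence the orbit itself closes up after \<open>N\<close> strikes if \<open>N\<close> is even, and only after
\<open>2 N\<close> strikes if \<open>N\<close> is odd.

The number \<open>N\<close> counts the crossings of lattice lines and of hexagon sides. The former are determined
by \<open>v\<close>. The latter are as many as the hexagons that the line meets, modulo \<open>v\<close>: a hexagon is met if
and only if the projection of its centre along \<open>v\<close> lies in a window whose length is the width of the
hexagon across \<open>v\<close>. The projected lattice is a copy of the integers, and in its unit the window has
length \<open>y + x / 3\<close> if \<open>x\<close> and \<open>y\<close> are both odd, and twice that otherwise. So the number of hexagons is
that length rounded down or up, depending on the position of the line; this is the origin of the
two alternatives when \<open>3\<close> does not divide \<open>x\<close>.

In the formal proof the tiles that the line meets, modulo \<open>v\<close>, are the elements of a finite set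
\<open>states\<close> of pairs of an integer (the projected hexagon centre) and one of six sectors, and passing to
the next tile is a permutation \<open>step\<close> of that set. Half-open windows keep \<open>step\<close> a permutation even
when the line would meet a vertex somewhere, so nothing has to be assumed about tiles that the orbit
is not yet known to visit. That the permutation is a single cycle (\<open>returns_after_card\<close>) replaces all
topological arguments about the tiling: every invariant set of states climbs by at least the height
of \<open>v\<close> (\<open>invariant_climbs\<close>), while all states together climb exactly by that height
(\<open>card_climbing_states\<close>). The lemma \<open>orbit_bounce\<close> extracts from the billiard orbit the linear data
which \<open>orbit_returns_iff\<close> feeds into \<open>step\<close>.\<close>

section \<open>The kite in skew coordinates\<close>

lemma polygon_edges_quadrilateral:
  "polygon_edges [a, b, c, d] = {(a, b), (b, c), (c, d), (d, a)}"
proof -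
  let ?vs = "[a, b, c, d]"
  have "{..<length ?vs} = {0, 1, 2, 3}" by auto
  moreover have "polygon_edges ?vs = (\<lambda>i. (?vs ! i, ?vs ! (Suc i mod length ?vs))) ` {..<length ?vs}"
    unfolding polygon_edges_def by blast
  ultimately show ?thesis by simp
qed

lemma reflect_vector_scaleR [simp]:
  assumes "c \<noteq> 0"
  shows "reflect_vector (c *\<^sub>R d) v = reflect_vector d v"
  using assms by (simp add: reflect_vector_def)

lemma reflect_vector_minus [simp]: "reflect_vector (- d) v = reflect_vector d v"
  by (simp add: reflect_vector_def)

lemma reflect_vector_scaleR_right:
  "reflect_vector d (c *\<^sub>R v) = c *\<^sub>R reflect_vector d v"
  by (simp add: reflect_vector_def algebra_simps)

lemma sqrt3_assoc: "sqrt 3 * (sqrt 3 * x) = 3 * x"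
  by (simp flip: mult.assoc)

lemma reflect_vector_60: "reflect_vector (Complex 1 (sqrt 3)) w =
    Complex ((sqrt 3 * Im w - Re w) / 2) ((sqrt 3 * Re w + Im w) / 2)"
  by (simp add: reflect_vector_def inner_complex_def complex_eq_iff field_simps sqrt3_assoc)

lemma reflect_vector_150: "reflect_vector (Complex (- sqrt 3) 1) w =
    Complex ((Re w - sqrt 3 * Im w) / 2) (- (sqrt 3 * Re w + Im w) / 2)"
  by (simp add: reflect_vector_def inner_complex_def complex_eq_iff field_simps sqrt3_assoc)

lemma reflect_vector_axis: "reflect_vector (Complex 1 0) w = Complex (Re w) (- Im w)"
  "reflect_vector (Complex 0 1) w = Complex (- Re w) (Im w)"
  by (simp_all add: reflect_vector_def inner_complex_def complex_eq_iff)

text \<open>A strike at the point \<open>(\<xi>, \<eta>)\<close> with incoming direction \<open>(u, v)\<close> and outgoing direction \<open>(u', v')\<close>; the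
four lines belong to \<open>AM\<close>, \<open>AD\<close>, \<open>MB\<close> and \<open>BD\<close>. Only the ray of the outgoing direction matters, whence
the factor \<open>c\<close>.\<close>

definition bounce :: "real \<Rightarrow> real \<Rightarrow> real \<Rightarrow> real \<Rightarrow> real \<Rightarrow> real \<Rightarrow> bool" where
  "bounce \<xi> \<eta> u v u' v' \<longleftrightarrow> (\<exists>c>0.
     \<eta> = 0 \<and> 0 < \<xi> \<and> \<xi> < 1/2 \<and> v < 0 \<and> u' = c * (u + v) \<and> v' = - c * v \<or>
     \<xi> = 0 \<and> 0 < \<eta> \<and> \<eta> < 1/2 \<and> u < 0 \<and> u' = - c * u \<and> v' = c * (u + v) \<or>
     2 * \<xi> + \<eta> = 1 \<and> 0 < \<eta> \<and> \<eta> < 1/3 \<and> 0 < 2 * u + v \<and> u' = - c * (u + v) \<and> v' = c * v \<or>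
     \<xi> + 2 * \<eta> = 1 \<and> 0 < \<xi> \<and> \<xi> < 1/3 \<and> 0 < u + 2 * v \<and> u' = c * u \<and> v' = - c * (u + v))"

text \<open>Skew coordinates along \<open>AM\<close> and \<open>AD\<close>, scaled so that both edges have length one half. They span an
angle of 60 degrees, and the symmetry of the kite in \<open>AB\<close> exchanges the two coordinates.\<close>

locale kite_frame =
  fixes A :: complex and l :: real
  assumes l_pos: "0 < l"
begin

definition pt :: "real \<Rightarrow> real \<Rightarrow> complex" where
  "pt \<xi> \<eta> = A + l *\<^sub>R Complex (\<xi> + \<eta> / 2) (sqrt 3 / 2 * \<eta>)"

definition xlin :: "complex \<Rightarrow> real" where "xlin w = (Re w - sqrt 3 * Im w / 3) / l"
definition ylin :: "complex \<Rightarrow> real" where "ylin w = (2 * sqrt 3 * Im w / 3) / l"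

definition xcoord :: "complex \<Rightarrow> real" where "xcoord z = xlin (z - A)"
definition ycoord :: "complex \<Rightarrow> real" where "ycoord z = ylin (z - A)"

lemma lin_add: "xlin (v + w) = xlin v + xlin w" "ylin (v + w) = ylin v + ylin w"
  by (simp_all add: xlin_def ylin_def add_divide_distrib diff_divide_distrib algebra_simps)

lemma lin_scaleR: "xlin (c *\<^sub>R w) = c * xlin w" "ylin (c *\<^sub>R w) = c * ylin w"
  by (simp_all add: xlin_def ylin_def diff_divide_distrib algebra_simps)

lemma coord_diff: "xcoord q - xcoord p = xlin (q - p)" "ycoord q - ycoord p = ylin (q - p)"
  using lin_add[of "q - p" "p - A"] by (simp_all add: xcoord_def ycoord_def)

lemma coord_pt [simp]: "xcoord (pt \<xi> \<eta>) = \<xi>" "ycoord (pt \<xi> \<eta>) = \<eta>"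
  using l_pos by (simp_all add: pt_def xcoord_def ycoord_def xlin_def ylin_def field_simps sqrt3_assoc)

lemma pt_coord [simp]: "pt (xcoord z) (ycoord z) = z"
  using l_pos by (simp add: pt_def xcoord_def ycoord_def xlin_def ylin_def complex_eq_iff field_simps sqrt3_assoc)

lemma coord_affine:
  "xcoord ((1 - u) *\<^sub>R a + u *\<^sub>R b) = (1 - u) * xcoord a + u * xcoord b"
  "ycoord ((1 - u) *\<^sub>R a + u *\<^sub>R b) = (1 - u) * ycoord a + u * ycoord b"
proof -
  have "(1 - u) *\<^sub>R a + u *\<^sub>R b - A = (1 - u) *\<^sub>R (a - A) + u *\<^sub>R (b - A)"
    by (simp add: algebra_simps)
  then show "xcoord ((1 - u) *\<^sub>R a + u *\<^sub>R b) = (1 - u) * xcoord a + u * xcoord b"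
    "ycoord ((1 - u) *\<^sub>R a + u *\<^sub>R b) = (1 - u) * ycoord a + u * ycoord b"
    by (simp_all only: xcoord_def ycoord_def lin_add lin_scaleR)
qed

lemma coord_segment:
  assumes "z \<in> open_segment a b"
  obtains u where "0 < u" "u < 1" "xcoord z = (1 - u) * xcoord a + u * xcoord b"
    "ycoord z = (1 - u) * ycoord a + u * ycoord b"
  using assms coord_affine that by (auto simp: in_segment)

lemma in_closed_segment_coord:
  assumes "0 \<le> u" "u \<le> 1" "xcoord z = (1 - u) * xcoord a + u * xcoord b"
    "ycoord z = (1 - u) * ycoord a + u * ycoord b"
  shows "z \<in> closed_segment a b"
proof -
  have "z = (1 - u) *\<^sub>R a + u *\<^sub>R b"
    by (metis assms(3,4) coord_affine pt_coord)
  then show ?thesis using assms by (auto simp: in_segment)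
qed

abbreviation "M \<equiv> pt (1/2) 0"
abbreviation "B \<equiv> pt (1/3) (1/3)"
abbreviation "D \<equiv> pt 0 (1/2)"

lemma coord_A [simp]: "xcoord A = 0" "ycoord A = 0"
  by (simp_all add: xcoord_def ycoord_def xlin_def ylin_def)

text \<open>The intersection of the four closed half-planes that are bounded by the edge lines.\<close>

definition kite_hull :: "complex set" where
  "kite_hull = {z. 0 \<le> xcoord z \<and> 0 \<le> ycoord z \<and> 2 * xcoord z + ycoord z \<le> 1 \<and> xcoord z + 2 * ycoord z \<le> 1}"

lemma convex_kite_hull: "convex kite_hull"
proof (rule convexI)
  fix a b and s t :: real
  assume ab: "a \<in> kite_hull" "b \<in> kite_hull" and st: "0 \<le> s" "0 \<le> t" "s + t = 1"
  have s: "s = 1 - t" using st by simp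
  have "(1 - t) * (2 * xcoord a + ycoord a) + t * (2 * xcoord b + ycoord b) \<le> (1 - t) * 1 + t * 1"
    "(1 - t) * (xcoord a + 2 * ycoord a) + t * (xcoord b + 2 * ycoord b) \<le> (1 - t) * 1 + t * 1"
    using ab st unfolding s kite_hull_def by (intro add_mono mult_left_mono; simp)+
  moreover have "0 \<le> (1 - t) * xcoord a + t * xcoord b" "0 \<le> (1 - t) * ycoord a + t * ycoord b"
    using ab st by (auto simp: s kite_hull_def)
  ultimately show "s *\<^sub>R a + t *\<^sub>R b \<in> kite_hull"
    unfolding s kite_hull_def mem_Collect_eq coord_affine by (simp add: algebra_simps)
qed

lemma edge_hull:
  assumes "(a, b) \<in> polygon_edges [A, M, B, D]"
  shows "closed_segment a b \<subseteq> kite_hull"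
proof -
  have "A \<in> kite_hull" "M \<in> kite_hull" "B \<in> kite_hull" "D \<in> kite_hull"
    by (simp_all add: kite_hull_def)
  then have "a \<in> kite_hull" "b \<in> kite_hull"
    using assms unfolding polygon_edges_quadrilateral by blast+
  then show ?thesis by (intro closed_segment_subset convex_kite_hull)
qed

lemma hull_edge:
  assumes "z \<in> kite_hull"
  shows "ycoord z = 0 \<Longrightarrow> z \<in> closed_segment A M"
    and "2 * xcoord z + ycoord z = 1 \<Longrightarrow> z \<in> closed_segment M B"
    and "xcoord z + 2 * ycoord z = 1 \<Longrightarrow> z \<in> closed_segment B D"
    and "xcoord z = 0 \<Longrightarrow> z \<in> closed_segment D A"
proof -
  note z = assms[unfolded kite_hull_def mem_Collect_eq]
  show "ycoord z = 0 \<Longrightarrow> z \<in> closed_segment A M"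
    by (rule in_closed_segment_coord[of "2 * xcoord z"]) (use z in simp_all)
  show "2 * xcoord z + ycoord z = 1 \<Longrightarrow> z \<in> closed_segment M B"
    by (rule in_closed_segment_coord[of "3 * ycoord z"]) (use z in \<open>simp_all add: field_simps\<close>)
  show "xcoord z + 2 * ycoord z = 1 \<Longrightarrow> z \<in> closed_segment B D"
    by (rule in_closed_segment_coord[of "1 - 3 * xcoord z"]) (use z in \<open>simp_all add: field_simps\<close>)
  show "xcoord z = 0 \<Longrightarrow> z \<in> closed_segment D A"
    by (rule in_closed_segment_coord[of "1 - 2 * ycoord z"]) (use z in \<open>simp_all add: field_simps\<close>)
qed

text \<open>A leg between two points of one edge would stay in the boundary.\<close>

lemma leg_not_along_edge:
  assumes "(a, b) \<in> polygon_edges [A, M, B, D]" and "p \<in> closed_segment a b"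
    and "q \<noteq> p" and "open_segment p q \<subseteq> polygon_interior [A, M, B, D]"
  shows "q \<notin> closed_segment a b"
proof
  assume "q \<in> closed_segment a b"
  then have "open_segment p q \<subseteq> closed_segment a b"
    using assms(2) by (meson closed_segment_subset convex_closed_segment order_trans segment_open_subset_closed)
  also have "\<dots> \<subseteq> polygon_boundary [A, M, B, D]"
    using assms(1) by (auto simp: polygon_boundary_def)
  finally have "open_segment p q = {}"
    using assms(4) inside_no_overlap unfolding polygon_interior_def by blast
  then show False using assms(3) by simp
qed

text \<open>Together with the half-planes this makes legs transversal: they arrive at an edge strictly from the
inside, and the first one leaves \<open>AM\<close> strictly upwards.\<close>

lemma leg_ends:
  assumes "p \<in> kite_hull" "q \<in> kite_hull" "q \<noteq> p"
    and "open_segment p q \<subseteq> polygon_interior [A, M, B, D]"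
  shows "ycoord q = 0 \<Longrightarrow> 0 < ycoord p"
    and "2 * xcoord q + ycoord q = 1 \<Longrightarrow> 2 * xcoord p + ycoord p < 1"
    and "xcoord q + 2 * ycoord q = 1 \<Longrightarrow> xcoord p + 2 * ycoord p < 1"
    and "xcoord q = 0 \<Longrightarrow> 0 < xcoord p"
    and "ycoord p = 0 \<Longrightarrow> 0 < ycoord q"
proof -
  have E: "\<not> (p \<in> closed_segment a b \<and> q \<in> closed_segment a b)"
    if "(a, b) \<in> polygon_edges [A, M, B, D]" for a b
    using leg_not_along_edge[OF that _ assms(3,4)] by blast
  note E = E[of A M] E[of M B] E[of B D] E[of D A]
  note E = E[unfolded polygon_edges_quadrilateral, simplified]
  show "ycoord q = 0 \<Longrightarrow> 0 < ycoord p"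
    using E(1) hull_edge(1)[OF assms(1)] hull_edge(1)[OF assms(2)] assms(1)
    by (auto simp: kite_hull_def less_le)
  show "2 * xcoord q + ycoord q = 1 \<Longrightarrow> 2 * xcoord p + ycoord p < 1"
    using E(2) hull_edge(2)[OF assms(1)] hull_edge(2)[OF assms(2)] assms(1)
    by (auto simp: kite_hull_def less_le)
  show "xcoord q + 2 * ycoord q = 1 \<Longrightarrow> xcoord p + 2 * ycoord p < 1"
    using E(3) hull_edge(3)[OF assms(1)] hull_edge(3)[OF assms(2)] assms(1)
    by (auto simp: kite_hull_def less_le)
  show "xcoord q = 0 \<Longrightarrow> 0 < xcoord p"
    using E(4) hull_edge(4)[OF assms(1)] hull_edge(4)[OF assms(2)] assms(1)
    by (auto simp: kite_hull_def less_le)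
  show "ycoord p = 0 \<Longrightarrow> 0 < ycoord q"
    using E(1) hull_edge(1)[OF assms(1)] hull_edge(1)[OF assms(2)] assms(2)
    by (auto simp: kite_hull_def less_le)
qed

text \<open>The edges have the directions 0, 90, 150 and 60 degrees. In skew coordinates the four reflections
have integer matrices, so that an orbit can be followed without square roots.\<close>

lemma lin_reflect:
  "xlin (reflect_vector (M - A) w) = xlin w + ylin w" "ylin (reflect_vector (M - A) w) = - ylin w"
  "xlin (reflect_vector (B - M) w) = - xlin w - ylin w" "ylin (reflect_vector (B - M) w) = ylin w"
  "xlin (reflect_vector (D - B) w) = xlin w" "ylin (reflect_vector (D - B) w) = - xlin w - ylin w"
  "xlin (reflect_vector (A - D) w) = - xlin w" "ylin (reflect_vector (A - D) w) = xlin w + ylin w"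
proof -
  have d: "M - A = (l/2) *\<^sub>R Complex 1 0" "B - M = (l * sqrt 3 / 6) *\<^sub>R Complex 0 1"
    "D - B = (l * sqrt 3 / 12) *\<^sub>R Complex (- sqrt 3) 1" "A - D = (- l / 4) *\<^sub>R Complex 1 (sqrt 3)"
    by (simp_all add: pt_def complex_eq_iff)
  show "xlin (reflect_vector (M - A) w) = xlin w + ylin w" "ylin (reflect_vector (M - A) w) = - ylin w"
  "xlin (reflect_vector (B - M) w) = - xlin w - ylin w" "ylin (reflect_vector (B - M) w) = ylin w"
  "xlin (reflect_vector (D - B) w) = xlin w" "ylin (reflect_vector (D - B) w) = - xlin w - ylin w"
  "xlin (reflect_vector (A - D) w) = - xlin w" "ylin (reflect_vector (A - D) w) = xlin w + ylin w"
    unfolding d using l_pos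
    by (simp_all add: reflect_vector_60 reflect_vector_150 reflect_vector_axis xlin_def ylin_def
        field_simps sqrt3_assoc)
qed

lemma open_edge_coord:
  "z \<in> open_segment A M \<Longrightarrow> ycoord z = 0 \<and> 0 < xcoord z \<and> xcoord z < 1/2"
  "z \<in> open_segment M B \<Longrightarrow> 2 * xcoord z + ycoord z = 1 \<and> 0 < ycoord z \<and> ycoord z < 1/3"
  "z \<in> open_segment B D \<Longrightarrow> xcoord z + 2 * ycoord z = 1 \<and> 0 < xcoord z \<and> xcoord z < 1/3"
  "z \<in> open_segment D A \<Longrightarrow> xcoord z = 0 \<and> 0 < ycoord z \<and> ycoord z < 1/2"
  by (auto elim!: coord_segment simp: field_simps)

lemma orbit_in_hull:
  assumes "nonsingular_orbit [A, M, B, D] p"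
  shows "p k \<in> kite_hull"
proof -
  have "\<exists>(a, b)\<in>polygon_edges [A, M, B, D]. p k \<in> open_segment a b"
    using assms unfolding nonsingular_orbit_def by (cases k) blast+
  then show ?thesis using edge_hull segment_open_subset_closed by fast
qed

text \<open>Unit velocities may be replaced by the legs themselves, because a positive factor is absorbed by the
constant of \<open>bounce\<close>.\<close>

lemma orbit_bounce:
  assumes "nonsingular_orbit [A, M, B, D] p"
  shows "bounce (xcoord (p (Suc k))) (ycoord (p (Suc k)))
    (xcoord (p (Suc k)) - xcoord (p k)) (ycoord (p (Suc k)) - ycoord (p k))
    (xcoord (p (Suc (Suc k))) - xcoord (p (Suc k))) (ycoord (p (Suc (Suc k))) - ycoord (p (Suc k)))"
proof -
  define w where "w = p (Suc k) - p k"
  define w' where "w' = p (Suc (Suc k)) - p (Suc k)"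
  have ne: "p (Suc k) \<noteq> p k" "p (Suc (Suc k)) \<noteq> p (Suc k)"
    and int: "open_segment (p k) (p (Suc k)) \<subseteq> polygon_interior [A, M, B, D]"
    using assms unfolding nonsingular_orbit_def by blast+
  from assms obtain a b where e: "(a, b) \<in> polygon_edges [A, M, B, D]" "p (Suc k) \<in> open_segment a b"
    and r: "sgn w' = reflect_vector (b - a) (sgn w)"
    unfolding nonsingular_orbit_def w_def w'_def by blast
  define c where "c = norm w' / norm w"
  have c: "c > 0" using ne by (simp add: c_def w_def w'_def)
  have "w' = norm w' *\<^sub>R sgn w'" using ne(2) by (simp add: sgn_div_norm w'_def)
  also have "\<dots> = c *\<^sub>R reflect_vector (b - a) w"
    unfolding r by (simp add: sgn_div_norm reflect_vector_scaleR_right c_def divide_inverse)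
  finally have w': "w' = c *\<^sub>R reflect_vector (b - a) w" .
  note ends = leg_ends[OF orbit_in_hull[OF assms] orbit_in_hull[OF assms] ne(1) int]
  have du: "xcoord (p (Suc k)) - xcoord (p k) = xlin w" "ycoord (p (Suc k)) - ycoord (p k) = ylin w"
    "xcoord (p (Suc (Suc k))) - xcoord (p (Suc k)) = xlin w'" "ycoord (p (Suc (Suc k))) - ycoord (p (Suc k)) = ylin w'"
    by (simp_all add: coord_diff w_def w'_def)
  have pk: "xcoord (p k) = xcoord (p (Suc k)) - xlin w" "ycoord (p k) = ycoord (p (Suc k)) - ylin w"
    using du by auto
  let ?x = "xcoord (p (Suc k))" and ?y = "ycoord (p (Suc k))"
  note pk' = ends[unfolded pk]
  from e(1) consider "a = A" "b = M" | "a = M" "b = B" | "a = B" "b = D" | "a = D" "b = A"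
    unfolding polygon_edges_quadrilateral by blast
  then show ?thesis
  proof cases
    case 1
    have "xlin w' = c * (xlin w + ylin w)" "ylin w' = - c * ylin w"
      unfolding w' 1 lin_scaleR lin_reflect by simp_all
    moreover have "?y = 0" "0 < ?x" "?x < 1/2" "ylin w < 0"
      using open_edge_coord(1)[of "p (Suc k)"] e(2) pk'(1) 1 by auto
    ultimately show ?thesis unfolding bounce_def du using c by blast
  next
    case 2
    have "xlin w' = - c * (xlin w + ylin w)" "ylin w' = c * ylin w"
      unfolding w' 2 lin_scaleR lin_reflect by (simp_all add: algebra_simps)
    moreover have "2 * ?x + ?y = 1" "0 < ?y" "?y < 1/3"
      using open_edge_coord(2)[of "p (Suc k)"] e(2) 2 by auto
    moreover have "0 < 2 * xlin w + ylin w" using pk'(2)[OF calculation(3)] calculation(3) by (simp add: algebra_simps)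
    ultimately show ?thesis unfolding bounce_def du using c by blast
  next
    case 3
    have "xlin w' = c * xlin w" "ylin w' = - c * (xlin w + ylin w)"
      unfolding w' 3 lin_scaleR lin_reflect by (simp_all add: algebra_simps)
    moreover have "?x + 2 * ?y = 1" "0 < ?x" "?x < 1/3"
      using open_edge_coord(3)[of "p (Suc k)"] e(2) 3 by auto
    moreover have "0 < xlin w + 2 * ylin w" using pk'(3)[OF calculation(3)] calculation(3) by (simp add: algebra_simps)
    ultimately show ?thesis unfolding bounce_def du using c by blast
  next
    case 4
    have "xlin w' = - c * xlin w" "ylin w' = c * (xlin w + ylin w)"
      unfolding w' 4 lin_scaleR lin_reflect by simp_all
    moreover have "?x = 0" "0 < ?y" "?y < 1/2" "xlin w < 0"
      using open_edge_coord(4)[of "p (Suc k)"] e(2) pk'(4) 4 by auto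
    ultimately show ?thesis unfolding bounce_def du using c by blast
  qed
qed

end

text \<open>The angle of 120 degrees at the apex forces \<open>AM\<close> to be \<open>sqrt 3\<close> times as long as \<open>MB\<close>; the scale of the
coordinates is then twice the length of \<open>AM\<close>.\<close>

lemma kite_frame_exists:
  assumes "kite_60_90_120 A M B D"
  obtains l where "0 < l" "M = kite_frame.pt A l (1/2) 0" "B = kite_frame.pt A l (1/3) (1/3)"
    "D = kite_frame.pt A l 0 (1/2)"
proof -
  from assms obtain C where C: "Im A = Im C" "Re A < Re C" "Im A < Im B"
    "dist A B = dist C B" "angle_between (A - B) (C - B) = 2 * pi / 3"
    "M = midpoint A C" "D = reflect_point A B M"
    unfolding kite_60_90_120_def by blast
  define m where "m = (Re C - Re A) / 2"
  define h where "h = Im B - Im A"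
  have m: "m > 0" and h: "h > 0" using C by (auto simp: m_def h_def)
  have "(dist A B)\<^sup>2 = (dist C B)\<^sup>2" using C by simp
  then have "(Re A - Re B)\<^sup>2 = (Re C - Re B)\<^sup>2"
    using C(1) by (simp add: dist_norm cmod_power2)
  then have ReB: "Re B = Re A + m"
    using C(2) by (auto simp: power2_eq_iff m_def field_simps)
  have AB: "A - B = Complex (-m) (-h)" and CB: "C - B = Complex m (-h)"
    using C(1) ReB by (auto simp: complex_eq_iff m_def h_def field_simps)
  have n: "norm (A - B) * norm (C - B) = m\<^sup>2 + h\<^sup>2"
    unfolding AB CB by (simp add: cmod_def)
  have ip: "(A - B) \<bullet> (C - B) = h\<^sup>2 - m\<^sup>2"
    unfolding AB CB by (simp add: inner_complex_def power2_eq_square)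
  define q where "q = (h\<^sup>2 - m\<^sup>2) / (m\<^sup>2 + h\<^sup>2)"
  have pos: "m\<^sup>2 + h\<^sup>2 > 0" using m by (simp add: add_pos_nonneg)
  have "-1 \<le> q" "q \<le> 1" using pos by (auto simp: q_def field_simps)
  then have "q = cos (arccos q)" by simp
  also have "arccos q = 2 * pi / 3" using C(5) unfolding angle_between_def n ip q_def .
  finally have "q = - 1/2" by (simp add: cos_120)
  then have "h\<^sup>2 - m\<^sup>2 = - 1/2 * (m\<^sup>2 + h\<^sup>2)"
    using pos unfolding q_def by (simp only: divide_eq_eq split: if_splits)
  then have "m\<^sup>2 = 3 * h\<^sup>2" by (auto simp: field_simps)
  then have "m\<^sup>2 = (sqrt 3 * h)\<^sup>2" by (simp add: power_mult_distrib)
  then have mh: "m = sqrt 3 * h" using m h by (simp add: power2_eq_iff_nonneg)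
  have fr: "kite_frame (2 * m)" using m by unfold_locales simp
  have hm: "h = m * sqrt 3 / 3" using mh by (simp add: field_simps)
  have M: "M = kite_frame.pt A (2 * m) (1/2) 0"
    unfolding kite_frame.pt_def[OF fr] using C(1,6)
    by (simp add: complex_eq_iff midpoint_def m_def field_simps)
  have B: "B = kite_frame.pt A (2 * m) (1/3) (1/3)"
    unfolding kite_frame.pt_def[OF fr] using ReB hm
    by (simp add: complex_eq_iff h_def field_simps)
  have dB: "B - A = h *\<^sub>R Complex (sqrt 3) 1" and dM: "M - A = Complex m 0"
    using ReB mh C(1) by (auto simp: complex_eq_iff h_def C(6) midpoint_def m_def field_simps)
  have D: "D = kite_frame.pt A (2 * m) 0 (1/2)"
    unfolding C(7) reflect_point_def dB dM kite_frame.pt_def[OF fr] using h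
    by (simp add: reflect_vector_def inner_complex_def complex_eq_iff field_simps)
  show thesis using that[OF _ M B D] m by simp
qed

text \<open>As \<open>arccos\<close> does not see the side of \<open>AM\<close> to which \<open>w\<close> points, the angle fixes \<open>w\<close> up to a positive factor
only together with the sign of its height. The vector \<open>(x, y sqrt 3)\<close> has skew coordinates
\<open>(x - y, 2 y)\<close>.\<close>

lemma (in kite_frame) initial_direction:
  assumes "0 < x" "0 < y" and r: "0 < r"
    and ang: "angle_between (complex_of_real r) w = arctan (y / x * sqrt 3)" and w: "0 < ylin w"
  obtains c where "0 < c" "xlin w = c * (x - y)" "ylin w = c * (2 * y)"
proof -
  define T where "T = y / x * sqrt 3"
  have T: "T > 0" using assms by (simp add: T_def)
  have Im: "Im w > 0" using w l_pos by (simp add: ylin_def zero_less_divide_iff zero_less_mult_iff)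
  define q where "q = Re w / norm w"
  have nw: "norm w > 0" using Im by auto
  have "\<bar>q\<bar> \<le> 1" using nw abs_Re_le_cmod[of w] by (simp add: q_def)
  then have "q = cos (arccos q)" by (simp add: abs_le_iff)
  also have "arccos q = arctan T"
    using ang r unfolding angle_between_def T_def q_def by (simp add: inner_complex_def)
  also have "cos (arctan T) = 1 / sqrt (1 + T\<^sup>2)" by (rule cos_arctan)
  finally have q: "q = 1 / sqrt (1 + T\<^sup>2)" .
  have s: "sqrt (1 + T\<^sup>2) > 0" by (simp add: add_pos_nonneg)
  have norm_eq: "norm w = Re w * sqrt (1 + T\<^sup>2)" using q s nw by (simp add: q_def field_simps)
  have Re: "Re w > 0" using nw s unfolding norm_eq by (rule zero_less_mult_pos2)
  from norm_eq have "(norm w)\<^sup>2 = (Re w)\<^sup>2 * (1 + T\<^sup>2)" by (simp add: power_mult_distrib)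
  then have "(Im w)\<^sup>2 = (Re w * T)\<^sup>2" by (simp add: cmod_power2 algebra_simps)
  then have Im_eq: "Im w = Re w * T" using Im Re T by (simp add: power2_eq_iff_nonneg)
  show thesis
  proof
    show "0 < Re w / (l * x)" using Re l_pos assms by simp
    show "xlin w = Re w / (l * x) * (x - y)" "ylin w = Re w / (l * x) * (2 * y)"
      using l_pos assms by (simp_all add: xlin_def ylin_def Im_eq T_def field_simps sqrt3_assoc)
  qed
qed

section \<open>A permutation of finitely many states\<close>

text \<open>The sector tells which of the six kites of a hexagon a tile is, counted counterclockwise; \<open>K0\<close> is the
kite with its edge \<open>AM\<close> pointing to the right.\<close>

datatype sector = K0 | K1 | K2 | K3 | K4 | K5

lemma UNIV_sector: "(UNIV::sector set) = {K0,K1,K2,K3,K4,K5}"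
  using sector.exhaust by blast

lemma sum_increments_invariant_set:
  fixes h :: "'a \<Rightarrow> int"
  assumes "inj_on f T" "f ` T = T"
  shows "(\<Sum>s\<in>T. h (f s) - h s) = 0"
proof -
  have "(\<Sum>s\<in>T. h (f s)) = sum h (f ` T)"
    using sum.reindex[OF assms(1), of h] by simp
  then show ?thesis using assms(2) by (simp add: sum_subtractf)
qed

definition lattice_window :: "real \<Rightarrow> real \<Rightarrow> real \<Rightarrow> int set" where
  "lattice_window g lo hi = {n. lo < g - of_int n \<and> g - of_int n \<le> hi}"

lemma lattice_window_eq: "lattice_window g lo hi = {\<lceil>g - hi\<rceil>..<\<lceil>g - lo\<rceil>}"
  unfolding lattice_window_def
  by (auto simp: less_ceiling_iff ceiling_le_iff)

lemma finite_lattice_window: "finite (lattice_window g lo hi)"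
  by (simp add: lattice_window_eq)

lemma card_lattice_window:
  assumes "lo \<le> hi"
  shows "int (card (lattice_window g lo hi)) = \<lceil>g - lo\<rceil> - \<lceil>g - hi\<rceil>"
proof -
  have "\<lceil>g - hi\<rceil> \<le> \<lceil>g - lo\<rceil>" using assms by (intro ceiling_mono) auto
  then show ?thesis by (simp add: lattice_window_eq)
qed

text \<open>Let the primitive lattice vector \<open>v\<close> be \<open>- \<beta> e\<^sub>1 + (\<beta> + \<gamma>) e\<^sub>2\<close>, where \<open>e\<^sub>1\<close> and \<open>e\<^sub>2\<close> are the unit
vectors at 0 and 60 degrees, and project along \<open>v\<close> such that \<open>e\<^sub>1\<close>, \<open>e\<^sub>2\<close> and \<open>e\<^sub>2 - e\<^sub>1\<close> go to
\<open>- (\<beta> + \<gamma>)\<close>, \<open>- \<beta>\<close> and \<open>\<gamma>\<close>. The orbit line projects to the number \<open>g\<close>. The inequalities say that the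
direction of \<open>v\<close> lies strictly between 60 and 90 degrees.\<close>

locale kite_flow =
  fixes \<beta> \<gamma> :: int and g :: real
  assumes beta_pos: "0 < \<beta>" and beta_less: "\<beta> < \<gamma>" and coprime_beta_gamma: "coprime \<beta> \<gamma>"
begin

definition \<alpha> :: int where "\<alpha> = \<beta> + \<gamma>"

text \<open>Seen from the centre of its hexagon, the kite in sector \<open>r\<close> projects onto the interval from \<open>lower r\<close> to
\<open>upper r\<close>: the ends come from the centre itself, from the side midpoints (halves), and from the hexagon
corners (thirds).\<close>

fun lower :: "sector \<Rightarrow> real" where
  "lower K0 = - \<alpha> / 2" | "lower K1 = - \<beta> / 2" | "lower K2 = 0" | "lower K3 = 0"
| "lower K4 = - \<gamma> / 2" | "lower K5 = - (\<alpha> + \<gamma>) / 3"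

fun upper :: "sector \<Rightarrow> real" where
  "upper K0 = 0" | "upper K1 = \<gamma> / 2" | "upper K2 = (\<alpha> + \<gamma>) / 3" | "upper K3 = \<alpha> / 2"
| "upper K4 = \<beta> / 2" | "upper K5 = 0"

text \<open>The line meets the tile \<open>(n, r)\<close> if its offset \<open>g - n\<close> from the hexagon centre lies in this window. Half-open
windows fit together without gaps even if the offset hits the projection of a vertex.\<close>

definition states :: "(int \<times> sector) set" where
  "states = {(n, r). n \<in> lattice_window g (lower r) (upper r)}"

text \<open>The edge through which the line leaves a tile is the one whose projection contains the offset. Crossing
an edge at \<open>A\<close> changes only the sector; crossing a side of the hexagon moves the centre by \<open>e\<^sub>1\<close>, \<open>e\<^sub>2\<close> or
\<open>e\<^sub>2 - e\<^sub>1\<close>.\<close>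

fun step :: "int \<times> sector \<Rightarrow> int \<times> sector" where
  "step (n, K0) = (if g - n \<le> - (\<alpha> + \<beta>) / 3 then (n - \<alpha>, K2)
                   else if g - n \<le> - \<beta> / 2 then (n - \<beta>, K4) else (n, K1))"
| "step (n, K1) = (if g - n \<le> (\<gamma> - \<beta>) / 3 then (n - \<beta>, K3) else (n + \<gamma>, K5))"
| "step (n, K2) = (if g - n \<le> \<gamma> / 2 then (n, K1) else (n + \<gamma>, K4))"
| "step (n, K3) = (n, K2)"
| "step (n, K4) = (if g - n \<le> 0 then (n, K5) else (n, K3))"
| "step (n, K5) = (if g - n \<le> - \<alpha> / 2 then (n - \<alpha>, K3) else (n, K0))"

lemma parameter_order: "real_of_int \<alpha> = \<beta> + \<gamma>" "0 < real_of_int \<beta>" "real_of_int \<beta> < \<gamma>"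
  "\<alpha> = \<beta> + \<gamma>"
  using beta_pos beta_less by (auto simp: \<alpha>_def)

lemma step_states: "s \<in> states \<Longrightarrow> step s \<in> states"
  using parameter_order
  by (cases s; cases "snd s") (auto simp: states_def lattice_window_def field_simps)

lemma inj_step: "inj_on step states"
proof (rule inj_onI)
  fix s t assume st: "s \<in> states" "t \<in> states" "step s = step t"
  obtain n r where s: "s = (n, r)" by (cases s)
  obtain m q where t: "t = (m, q)" by (cases t)
  show "s = t"
    using st parameter_order unfolding s t
    by (cases r; cases q; auto simp: states_def lattice_window_def field_simps split: if_splits)
qed

lemma finite_states: "finite states"
proof -
  have "states \<subseteq> (\<Union>r\<in>UNIV. lattice_window g (lower r) (upper r)) \<times> UNIV"
    unfolding states_def by auto
  moreover have "finite \<dots>"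
    by (simp add: UNIV_sector finite_lattice_window)
  ultimately show ?thesis by (rule finite_subset)
qed

lemma step_image: "step ` states = states"
  using endo_inj_surj[OF finite_states _ inj_step] step_states by blast

text \<open>Within one hexagon the direction of travel forbids returning to a sector, which is what \<open>rank\<close>
records: a cycle of states has to change the hexagon.\<close>

fun rank :: "sector \<Rightarrow> int" where
  "rank K4 = 0" | "rank K5 = 1" | "rank K3 = 1" | "rank K0 = 2" | "rank K2 = 2" | "rank K1 = 3"

abbreviation shift :: "int \<times> sector \<Rightarrow> int" where
  "shift s \<equiv> fst (step s) - fst s"

lemma shift_cases: "shift s \<in> {0, -\<alpha>, -\<beta>, \<gamma>}"
  by (cases s; cases "snd s") auto

lemma rank_step: "shift s = 0 \<Longrightarrow> rank (snd s) + 1 \<le> rank (snd (step s))"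
  using parameter_order(2,3) beta_pos beta_less
  by (cases s; cases "snd s") (auto simp: \<alpha>_def split: if_splits)

text \<open>The steps to a higher row of hexagon centres; the translation \<open>v\<close> rises by \<open>\<alpha>\<close> rows.\<close>

definition climbs :: "int \<times> sector \<Rightarrow> bool" where
  "climbs s \<longleftrightarrow> shift s = - \<beta> \<or> shift s = \<gamma>"

text \<open>On an invariant set the increments of \<open>n\<close> cancel, so the hexagon moves add up to a multiple of \<open>v\<close>, because
\<open>v\<close> is primitive. The multiple is positive, because otherwise no hexagon move would occur at all,
contradicting \<open>rank\<close>.\<close>

lemma invariant_climbs:
  assumes T: "T \<subseteq> states" "T \<noteq> {}" "step ` T = T"
  shows "\<alpha> \<le> int (card {s\<in>T. climbs s})"
proof -
  have fin: "finite T" using T(1) finite_states by (rule finite_subset)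
  have inj: "inj_on step T" using inj_step T(1) by (rule inj_on_subset)
  define A where "A = {s\<in>T. shift s = - \<alpha>}"
  define B where "B = {s\<in>T. shift s = - \<beta>}"
  define C where "C = {s\<in>T. shift s = \<gamma>}"
  have ne: "\<alpha> \<noteq> \<beta>" "\<alpha> > 0" "\<beta> > 0" "\<gamma> > 0" using beta_pos beta_less by (auto simp: \<alpha>_def)
  have "0 = (\<Sum>s\<in>T. shift s)"
    using sum_increments_invariant_set[OF inj T(3)] by simp
  also have "\<dots> = (\<Sum>s\<in>T. (if shift s = - \<alpha> then - \<alpha> else 0) + (if shift s = - \<beta> then - \<beta> else 0)
      + (if shift s = \<gamma> then \<gamma> else 0))"
  proof (rule sum.cong[OF refl])
    fix s show "shift s = (if shift s = - \<alpha> then - \<alpha> else 0) + (if shift s = - \<beta> then - \<beta> else 0)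
      + (if shift s = \<gamma> then \<gamma> else 0)"
      using shift_cases[of s] ne by auto
  qed
  also have "\<dots> = - \<alpha> * int (card A) - \<beta> * int (card B) + \<gamma> * int (card C)"
    using fin by (simp add: sum.distrib A_def B_def C_def flip: sum.inter_filter)
  finally have bal: "\<beta> * (int (card A) + int (card B)) = \<gamma> * (int (card C) - int (card A))"
    by (simp add: \<alpha>_def algebra_simps)
  have "\<gamma> dvd \<beta> * (int (card A) + int (card B))" unfolding bal by simp
  then have "\<gamma> dvd int (card A) + int (card B)"
    using coprime_beta_gamma by (simp add: coprime_dvd_mult_right_iff coprime_commute)
  then obtain j where j: "int (card A) + int (card B) = \<gamma> * j" by (elim dvdE)
  have j2: "int (card C) - int (card A) = \<beta> * j"
  proof -
    have "\<gamma> * (int (card C) - int (card A)) = \<gamma> * (\<beta> * j)"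
      using bal unfolding j by (metis mult.left_commute)
    then show ?thesis using ne by simp
  qed
  have "j \<ge> 0" using j ne by (smt (verit) mult_pos_neg of_nat_0_le_iff)
  moreover have "j \<noteq> 0"
  proof
    assume "j = 0"
    then have "card A = 0" "card B = 0" "card C = 0" using j j2 by auto
    then have "A = {}" "B = {}" "C = {}" using fin by (auto simp: A_def B_def C_def)
    then have z: "shift s = 0" if "s \<in> T" for s
      using shift_cases[of s, unfolded insert_iff empty_iff] that
      unfolding A_def B_def C_def by blast
    \<comment> \<open>The ranks would increase at every state but sum up to the same value.\<close>
    have "0 < (\<Sum>s\<in>T. rank (snd (step s)) - rank (snd s))"
      by (rule sum_pos[OF fin T(2)]) (use rank_step z in fastforce)
    then show False using sum_increments_invariant_set[OF inj T(3), of "\<lambda>s. rank (snd s)"] by simp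
  qed
  ultimately have "j \<ge> 1" by simp
  then have "\<alpha> * 1 \<le> \<alpha> * j" using ne by (intro mult_left_mono) auto
  also have "\<dots> = int (card B) + int (card C)" using j j2 by (simp add: \<alpha>_def algebra_simps)
  also have "\<dots> = int (card (B \<union> C))"
    using fin ne by (subst card_Un_disjoint) (auto simp: B_def C_def)
  also have "B \<union> C = {s\<in>T. climbs s}" by (auto simp: B_def C_def climbs_def)
  finally show ?thesis by simp
qed

abbreviation crossings :: "real \<Rightarrow> int" where
  "crossings t \<equiv> \<lceil>g - t\<rceil>"

lemma crossings_shift: "crossings (t - of_int k) = crossings t + k"
  by (metis ceiling_add_of_int diff_diff_eq2 diff_add_eq)

text \<open>The windows of the climbing states are adjacent and form a single window of length \<open>\<alpha>\<close>, an integer, so their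
number does not depend on \<open>g\<close>.\<close>

lemma card_climbing_states: "int (card {s\<in>states. climbs s}) = \<alpha>"
proof -
  let ?W = "lattice_window g"
  have ne: "\<alpha> \<noteq> \<beta>" "\<alpha> > 0" "\<beta> > 0" "\<gamma> > 0" using beta_pos beta_less by (auto simp: \<alpha>_def)
  have eq: "{s\<in>states. climbs s} = ?W (-(\<alpha>+\<beta>)/3) (-\<beta>/2) \<times> {K0} \<union> ?W (-\<beta>/2) (\<gamma>/2) \<times> {K1} \<union> ?W (\<gamma>/2) ((\<alpha>+\<gamma>)/3) \<times> {K2}"
    (is "?L = ?R")
  proof (rule set_eqI)
    fix s :: "int \<times> sector"
    obtain n r where s: "s = (n, r)" by (cases s)
    show "s \<in> ?L \<longleftrightarrow> s \<in> ?R" unfolding s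
      using ne parameter_order(1-3)
      by (cases r) (auto simp: states_def lattice_window_def climbs_def)
  qed
  have "card ?R = card (?W (-(\<alpha>+\<beta>)/3) (-\<beta>/2)) + card (?W (-\<beta>/2) (\<gamma>/2)) + card (?W (\<gamma>/2) ((\<alpha>+\<gamma>)/3))"
    by (subst card_Un_disjoint; (subst card_Un_disjoint)?) (auto simp: finite_lattice_window card_cartesian_product)
  then have *: "int (card ?R) = crossings (-(\<alpha>+\<beta>)/3) - crossings ((\<alpha>+\<gamma>)/3)"
    using parameter_order(1-3) by (simp add: card_lattice_window)
  have **: "-(\<alpha>+\<beta>)/3 = (\<alpha>+\<gamma>)/3 - of_int \<alpha>" using parameter_order(1) by (simp add: field_simps)
  show ?thesis unfolding eq * by (subst **) (simp only: crossings_shift)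
qed

text \<open>The number of hexagons that the line meets modulo \<open>v\<close>; only this part of the number of states depends on \<open>g\<close>.\<close>

definition width :: int where
  "width = crossings (- (\<alpha> + \<gamma>) / 3) - crossings ((\<alpha> + \<gamma>) / 3)"

lemma width_bounds: "\<bar>3 * width - 2 * (\<alpha> + \<gamma>)\<bar> < 3"
proof -
  define w :: real where "w = (\<alpha> + \<gamma>) / 3"
  have w: "- (\<alpha> + \<gamma>) / 3 = - w" by (simp add: w_def minus_divide_left)
  have "width = \<lceil>g + w\<rceil> - \<lceil>g - w\<rceil>" unfolding width_def w by (simp add: w_def)
  then have "\<bar>real_of_int width - 2 * w\<bar> < 1" by linarith
  moreover have "\<bar>real_of_int (3 * width - 2 * (\<alpha> + \<gamma>))\<bar> = 3 * \<bar>real_of_int width - 2 * w\<bar>"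
    by (simp add: w_def field_simps)
  ultimately have "\<bar>real_of_int (3 * width - 2 * (\<alpha> + \<gamma>))\<bar> < real_of_int 3" by simp
  then show ?thesis by linarith
qed

text \<open>Grouped suitably, the windows of \<open>K0\<close>, \<open>K1\<close>, \<open>K3\<close> and \<open>K4\<close> have the integral lengths \<open>\<alpha>\<close>, \<open>\<beta>\<close> and \<open>\<gamma>\<close>;
those of \<open>K2\<close> and \<open>K5\<close>, which contain the two corners of extreme projection, cover a whole hexagon.\<close>

lemma card_states: "int (card states) = 2 * \<alpha> + width"
proof -
  let ?W = "\<lambda>r. lattice_window g (lower r) (upper r)"
  have ne: "\<alpha> \<noteq> \<beta>" "\<alpha> > 0" "\<beta> > 0" "\<gamma> > 0" using beta_pos beta_less by (auto simp: \<alpha>_def)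
  have "states = (\<lambda>(r, n). (n, r)) ` (SIGMA r:UNIV. ?W r)" by (auto simp: states_def)
  then have "card states = card (SIGMA r:UNIV. ?W r)"
    by (simp add: card_image inj_on_def)
  also have "\<dots> = (\<Sum>r\<in>UNIV. card (?W r))"
    by (subst card_SigmaI) (auto simp: UNIV_sector finite_lattice_window)
  finally have "int (card states) = (\<Sum>r\<in>UNIV. int (card (?W r)))" by simp
  also have "\<dots> = (\<Sum>r\<in>UNIV. crossings (lower r) - crossings (upper r))"
  proof (rule sum.cong[OF refl])
    fix r show "int (card (?W r)) = crossings (lower r) - crossings (upper r)"
      using parameter_order(1-3) by (intro card_lattice_window) (cases r, auto)
  qed
  also have "\<dots> = (crossings (- \<alpha> / 2) - crossings (\<alpha> / 2)) + (crossings (- \<beta> / 2) - crossings (\<beta> / 2))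
     + (crossings (- \<gamma> / 2) - crossings (\<gamma> / 2)) + width"
    unfolding UNIV_sector by (simp add: width_def)
  also have "- \<alpha> / 2 = \<alpha> / 2 - of_int \<alpha>" by simp
  also have "- \<beta> / 2 = \<beta> / 2 - of_int \<beta>" by simp
  also have "- \<gamma> / 2 = \<gamma> / 2 - of_int \<gamma>" by simp
  finally show ?thesis unfolding crossings_shift by (simp add: \<alpha>_def)
qed

lemma funpow_states: "s \<in> states \<Longrightarrow> (step ^^ n) s \<in> states"
  by (induction n) (auto simp: step_states)

text \<open>If the cycle of a state were not everything, both it and its complement would be invariant, and together
they would climb at least \<open>2 \<alpha>\<close>.\<close>

lemma returns_after_card:
  assumes s: "s \<in> states"
  shows "(step ^^ n) s = s \<longleftrightarrow> card states dvd n"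
proof -
  define orb where "orb = range (\<lambda>n. (step ^^ n) s)"
  have orb: "orb \<subseteq> states" "orb \<noteq> {}" using funpow_states[OF s] by (auto simp: orb_def)
  have fin: "finite orb" using orb(1) finite_states by (rule finite_subset)
  have "step ` orb \<subseteq> orb" by (auto simp: orb_def simp flip: funpow.simps(2) comp_apply[of step])
  then have img: "step ` orb = orb"
    using endo_inj_surj[OF fin] inj_on_subset[OF inj_step orb(1)] by blast
  have "orb = states"
  proof (rule ccontr)
    let ?R = "states - orb"
    assume "orb \<noteq> states"
    then have R: "?R \<subseteq> states" "?R \<noteq> {}" using orb by auto
    have "step ` ?R = ?R"
      using inj_on_image_set_diff[OF inj_step, of states orb] orb(1) img step_image by auto
    note inv = invariant_climbs[OF R this] invariant_climbs[OF orb img]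
    have "card {s\<in>states. climbs s} = card {s\<in>?R. climbs s} + card {s\<in>orb. climbs s}"
      using finite_states fin orb(1)
      by (subst card_Un_disjoint[symmetric]) (auto intro: arg_cong[where f=card])
    then show False using inv card_climbing_states beta_pos beta_less by (simp add: \<alpha>_def)
  qed
  have "s \<in> orb" unfolding orb_def by (rule range_eqI[of _ _ 0]) simp
  then obtain t where "t \<in> orb" "step t = s" using img by (metis imageE)
  then obtain m where "t = (step ^^ m) s" by (auto simp: orb_def)
  then have "(step ^^ Suc m) s = s" using \<open>step t = s\<close> by simp
  then have ex: "\<exists>n>0. (step ^^ n) s = s" by blast
  define l where "l = (LEAST n. 0 < n \<and> (step ^^ n) s = s)"
  have l: "0 < l" "(step ^^ l) s = s" using LeastI_ex[OF ex] by (auto simp: l_def)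
  have lmin: "\<not> (0 < n \<and> (step ^^ n) s = s)" if "n < l" for n
    using not_less_Least that unfolding l_def by blast
  have ret: "(step ^^ n) s = s \<longleftrightarrow> l dvd n" for n
  proof -
    have "(step ^^ n) s = (step ^^ (n mod l)) s" using funpow_mod_eq[OF l(2)] by metis
    moreover have "n mod l < l" using l(1) by simp
    ultimately show ?thesis using lmin[of "n mod l"] by (auto simp: dvd_eq_mod_eq_0)
  qed
  have "orb = (\<lambda>n. (step ^^ n) s) ` {..<l}"
  proof
    show "orb \<subseteq> (\<lambda>n. (step ^^ n) s) ` {..<l}"
      unfolding orb_def using l by (auto intro!: image_eqI[of _ _ "_ mod l"] simp: funpow_mod_eq)
  qed (auto simp: orb_def)
  moreover have "inj_on (\<lambda>n. (step ^^ n) s) {..<l}"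
  proof (rule linorder_inj_onI)
    fix i j assume ij: "i < j" "i \<in> {..<l}" "j \<in> {..<l}"
    show "(step ^^ i) s \<noteq> (step ^^ j) s"
    proof
      assume "(step ^^ i) s = (step ^^ j) s"
      then have "(step ^^ (l - j)) ((step ^^ i) s) = (step ^^ (l - j)) ((step ^^ j) s)" by simp
      then have "(step ^^ (l - j + i)) s = s" using l ij by (simp flip: funpow_add comp_apply[of "step ^^ _"])
      then show False using lmin[of "l - j + i"] ij by auto
    qed
  qed auto
  ultimately have "card orb = l" by (simp add: card_image)
  then show ?thesis using ret \<open>orb = states\<close> by simp
qed

end

section \<open>Billiard paths run through the states\<close>

lemma bounce_swap: "bounce \<xi> \<eta> u v u' v' \<Longrightarrow> bounce \<eta> \<xi> v u v' u'"
  unfolding bounce_def by (elim exE, rule_tac x=c in exI) (auto simp: add.commute)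

text \<open>How a line leaves the kite: in the frame of the current tile it is \<open>a \<xi> + b \<eta> = \<delta>\<close>, traversed in the
direction \<open>(b, - a)\<close>. It exits at \<open>(\<xi>, \<eta>)\<close> and has coefficients \<open>a'\<close>, \<open>b'\<close>, \<open>\<delta>'\<close> in the frame of the next tile.
The order of the edges is \<open>AM\<close>, \<open>AD\<close>, \<open>MB\<close>, \<open>BD\<close>.\<close>

definition exits :: "real \<Rightarrow> real \<Rightarrow> real \<Rightarrow> real \<Rightarrow> real \<Rightarrow> real \<Rightarrow> real \<Rightarrow> real \<Rightarrow> bool" where
  "exits a b \<delta> \<xi> \<eta> a' b' \<delta>' \<longleftrightarrow>
     0 < a \<and> 0 < \<delta> \<and> \<delta> < a/2 \<and> \<xi> = \<delta> / a \<and> \<eta> = 0 \<and> a' = a - b \<and> b' = a \<and> \<delta>' = \<delta> \<or>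
     b < 0 \<and> b/2 < \<delta> \<and> \<delta> < 0 \<and> \<xi> = 0 \<and> \<eta> = \<delta> / b \<and> a' = b \<and> b' = b - a \<and> \<delta>' = \<delta> \<or>
     0 < 2 * b - a \<and> a/2 < \<delta> \<and> \<delta> < (a + b)/3 \<and> \<xi> = (b - \<delta>) / (2 * b - a) \<and> \<eta> = 1 - 2 * \<xi> \<and>
       a' = b - a \<and> b' = - a \<and> \<delta>' = \<delta> - a \<or>
     0 < b - 2 * a \<and> (a + b)/3 < \<delta> \<and> \<delta> < b/2 \<and> \<eta> = (\<delta> - a) / (b - 2 * a) \<and> \<xi> = 1 - 2 * \<eta> \<and>
       a' = - b \<and> b' = a - b \<and> \<delta>' = \<delta> - b"

text \<open>The kite is convex, so the ranges of \<open>\<delta>\<close> for the four edges are disjoint.\<close>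

lemma exits_unique:
  assumes "exits a b \<delta> \<xi>\<^sub>1 \<eta>\<^sub>1 a\<^sub>1 b\<^sub>1 \<delta>\<^sub>1" "exits a b \<delta> \<xi>\<^sub>2 \<eta>\<^sub>2 a\<^sub>2 b\<^sub>2 \<delta>\<^sub>2"
  shows "\<xi>\<^sub>1 = \<xi>\<^sub>2 \<and> \<eta>\<^sub>1 = \<eta>\<^sub>2"
  using assms unfolding exits_def by (elim disjE conjE; force)

text \<open>The frame of the next tile arises from the reflection at the edge followed by the exchange of the two
coordinates, the symmetry of the kite. Hence consecutive frames differ by a rotation, and the
exchanged order of \<open>u'\<close> and \<open>v'\<close> in the hypothesis is intended.\<close>

lemma bounce_exits:
  assumes "bounce \<xi> \<eta> u v v' u'" and "0 < t" "u = t * b" "v = - t * a"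
  obtains a' b' t' where "exits a b (a * \<xi> + b * \<eta>) \<xi> \<eta> a' b' (a' * \<eta> + b' * \<xi>)"
    and "0 < t'" "u' = t' * b'" "v' = - t' * a'"
proof -
  from assms(1) obtain c where c: "c > 0" and B:
    "\<eta> = 0 \<and> 0 < \<xi> \<and> \<xi> < 1/2 \<and> v < 0 \<and> v' = c * (u + v) \<and> u' = - c * v \<or>
     \<xi> = 0 \<and> 0 < \<eta> \<and> \<eta> < 1/2 \<and> u < 0 \<and> v' = - c * u \<and> u' = c * (u + v) \<or>
     2 * \<xi> + \<eta> = 1 \<and> 0 < \<eta> \<and> \<eta> < 1/3 \<and> 0 < 2 * u + v \<and> v' = - c * (u + v) \<and> u' = c * v \<or>
     \<xi> + 2 * \<eta> = 1 \<and> 0 < \<xi> \<and> \<xi> < 1/3 \<and> 0 < u + 2 * v \<and> v' = c * u \<and> u' = - c * (u + v)"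
    unfolding bounce_def by blast
  have ct: "0 < c * t" using c assms(2) by simp
  from B show ?thesis
  proof (elim disjE conjE)
    assume h: "\<eta> = 0" "0 < \<xi>" "\<xi> < 1/2" "v < 0" "v' = c * (u + v)" "u' = - c * v"
    have a: "0 < a" using h(4) assms(2,4) by (simp add: zero_less_mult_iff)
    show thesis
    proof (rule that[of "a - b" a "c * t"])
      show "exits a b (a * \<xi> + b * \<eta>) \<xi> \<eta> (a - b) a ((a - b) * \<eta> + a * \<xi>)"
        unfolding exits_def using h a by (intro disjI1) (simp add: field_simps)
    qed (use ct h assms in \<open>simp_all add: algebra_simps\<close>)
  next
    assume h: "\<xi> = 0" "0 < \<eta>" "\<eta> < 1/2" "u < 0" "v' = - c * u" "u' = c * (u + v)"
    have b: "b < 0" using h(4) assms(2,3) by (simp add: mult_less_0_iff)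
    show thesis
    proof (rule that[of b "b - a" "c * t"])
      show "exits a b (a * \<xi> + b * \<eta>) \<xi> \<eta> b (b - a) (b * \<eta> + (b - a) * \<xi>)"
        unfolding exits_def using h b by (intro disjI2[OF disjI1]) (simp add: field_simps mult_less_0_iff)
    qed (use ct h assms in \<open>simp_all add: algebra_simps\<close>)
  next
    assume h: "2 * \<xi> + \<eta> = 1" "0 < \<eta>" "\<eta> < 1/3" "0 < 2 * u + v" "v' = - c * (u + v)" "u' = c * v"
    have "0 < t * (2 * b - a)" using h(4) assms(3,4) by (simp add: algebra_simps)
    then have s: "0 < 2 * b - a" using assms(2) by (simp add: zero_less_mult_iff)
    have e: "\<eta> = 1 - 2 * \<xi>" and x: "1/3 < \<xi>" "\<xi> < 1/2" using h by auto
    have "(2 * b - a) * \<xi> < (2 * b - a) * (1/2)" "(2 * b - a) * (1/3) < (2 * b - a) * \<xi>"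
      using s x by (intro mult_strict_left_mono; simp)+
    then have "a/2 < a * \<xi> + b * \<eta>" "a * \<xi> + b * \<eta> < (a + b)/3"
      unfolding e by (simp_all add: field_simps)
    moreover have "\<xi> = (b - (a * \<xi> + b * \<eta>)) / (2 * b - a)" using s unfolding e by (simp add: field_simps)
    moreover have "(b - a) * \<eta> + - a * \<xi> = a * \<xi> + b * \<eta> - a" unfolding e by (simp add: algebra_simps)
    ultimately have ex: "exits a b (a * \<xi> + b * \<eta>) \<xi> \<eta> (b - a) (- a) ((b - a) * \<eta> + - a * \<xi>)"
      unfolding exits_def using s e by blast
    show thesis
      by (rule that[OF ex ct]) (use h assms in \<open>simp_all add: algebra_simps\<close>)
  next
    assume h: "\<xi> + 2 * \<eta> = 1" "0 < \<xi>" "\<xi> < 1/3" "0 < u + 2 * v" "v' = c * u" "u' = - c * (u + v)"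
    have "0 < t * (b - 2 * a)" using h(4) assms(3,4) by (simp add: algebra_simps)
    then have s: "0 < b - 2 * a" using assms(2) by (simp add: zero_less_mult_iff)
    have e: "\<xi> = 1 - 2 * \<eta>" and x: "1/3 < \<eta>" "\<eta> < 1/2" using h by auto
    have "(b - 2 * a) * \<eta> < (b - 2 * a) * (1/2)" "(b - 2 * a) * (1/3) < (b - 2 * a) * \<eta>"
      using s x by (intro mult_strict_left_mono; simp)+
    then have "(a + b)/3 < a * \<xi> + b * \<eta>" "a * \<xi> + b * \<eta> < b/2"
      unfolding e by (simp_all add: field_simps)
    moreover have "\<eta> = (a * \<xi> + b * \<eta> - a) / (b - 2 * a)" using s unfolding e by (simp add: field_simps)
    moreover have "- b * \<eta> + (a - b) * \<xi> = a * \<xi> + b * \<eta> - b" unfolding e by (simp add: algebra_simps)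
    ultimately have ex: "exits a b (a * \<xi> + b * \<eta>) \<xi> \<eta> (- b) (a - b) (- b * \<eta> + (a - b) * \<xi>)"
      unfolding exits_def using s e by blast
    show thesis
      by (rule that[OF ex ct]) (use h assms in \<open>simp_all add: algebra_simps\<close>)
  qed
qed

context kite_flow begin

text \<open>The line in the frame of the sector \<open>r\<close>: the projections of the unit vectors at \<open>60 r\<close> and \<open>60 (r + 1)\<close>
degrees.\<close>

fun xcoeff :: "sector \<Rightarrow> int" where
  "xcoeff K0 = - \<alpha>" | "xcoeff K1 = - \<beta>" | "xcoeff K2 = \<gamma>" | "xcoeff K3 = \<alpha>" | "xcoeff K4 = \<beta>" | "xcoeff K5 = - \<gamma>"

fun ycoeff :: "sector \<Rightarrow> int" where
  "ycoeff K0 = - \<beta>" | "ycoeff K1 = \<gamma>" | "ycoeff K2 = \<alpha>" | "ycoeff K3 = \<beta>" | "ycoeff K4 = - \<gamma>" | "ycoeff K5 = - \<alpha>"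

lemma exits_step:
  assumes "exits (xcoeff r) (ycoeff r) (g - of_int n) \<xi> \<eta> a' b' \<delta>'"
    and "step (n, r) = (n', r')"
  shows "a' = xcoeff r'" "b' = ycoeff r'" "\<delta>' = g - of_int n'"
  using assms parameter_order(1-3) unfolding exits_def
  by (cases r; force split: if_splits)+

definition at_state :: "int \<times> sector \<Rightarrow> real \<Rightarrow> real \<Rightarrow> real \<Rightarrow> real \<Rightarrow> bool" where
  "at_state s x y u v \<longleftrightarrow>
     real_of_int (xcoeff (snd s)) * x + real_of_int (ycoeff (snd s)) * y = g - real_of_int (fst s) \<and>
     (\<exists>t>0. u = t * real_of_int (ycoeff (snd s)) \<and> v = - t * real_of_int (xcoeff (snd s)))"

lemma at_state_step:
  assumes "at_state s x y u v" and "bounce (x + u) (y + v) u v v' u'"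
  shows "at_state (step s) (y + v) (x + u) u' v'"
    and "\<exists>a' b' \<delta>'. exits (xcoeff (snd s)) (ycoeff (snd s)) (g - fst s) (x + u) (y + v) a' b' \<delta>'"
proof -
  obtain n r where s: "s = (n, r)" by (cases s)
  obtain n' r' where s': "step (n, r) = (n', r')" by (cases "step (n, r)")
  obtain t :: real where t: "t > 0" "u = t * ycoeff r" "v = - t * xcoeff r" and d: "xcoeff r * x + ycoeff r * y = g - n"
    using assms(1) by (auto simp: at_state_def s)
  obtain a' b' t' where ex: "exits (xcoeff r) (ycoeff r) (xcoeff r * (x + u) + ycoeff r * (y + v)) (x + u) (y + v) a' b'
       (a' * (y + v) + b' * (x + u))" and t': "0 < t'" "u' = t' * b'" "v' = - t' * a'"
    using bounce_exits[OF assms(2) t] by metis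
  have "xcoeff r * (x + u) + ycoeff r * (y + v) = g - n"
    using d unfolding t by (simp add: algebra_simps)
  note ex = ex[unfolded this]
  show "\<exists>a' b' \<delta>'. exits (xcoeff (snd s)) (ycoeff (snd s)) (g - fst s) (x + u) (y + v) a' b' \<delta>'"
    using ex s by auto
  show "at_state (step s) (y + v) (x + u) u' v'"
    using exits_step[OF ex s'] t' unfolding s s' at_state_def by auto
qed

text \<open>Frames of odd index are mirror images, so there the coordinates of the orbit have to be exchanged. A state
determines the point at which the tile is left, which gives the first claim. Conversely, a position
and a direction determine the state: no direction of a mirrored tile agrees with the initial one, as
that direction is no multiple of 30 degrees, so the number of strikes is even.\<close>

lemma orbit_returns_iff:
  fixes px py :: "nat \<Rightarrow> real" and c :: real
  assumes g: "g = - \<alpha> * px 0"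
    and start: "py 0 = 0" "0 < px 0" "px 0 < 1/2"
    and c: "c > 0" "px 1 - px 0 = - c * \<beta>" "py 1 - py 0 = c * \<alpha>"
    and b: "\<And>k. bounce (px (Suc k)) (py (Suc k)) (px (Suc k) - px k) (py (Suc k) - py k)
                  (px (Suc (Suc k)) - px (Suc k)) (py (Suc (Suc k)) - py (Suc k))"
  shows "even m \<Longrightarrow> card states dvd m \<Longrightarrow> 0 < k \<Longrightarrow> px (m + k) = px k \<and> py (m + k) = py k"
    and "px m = px 0 \<Longrightarrow> py m = py 0 \<Longrightarrow> px (Suc m) = px 1 \<Longrightarrow> py (Suc m) = py 1 \<Longrightarrow>
      even m \<and> card states dvd m"
proof -
  define s where "s k = (step ^^ k) (0, K0)" for k
  have s0: "(0, K0) \<in> states"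
  proof -
    have "0 < \<alpha> * px 0" "\<alpha> * px 0 < \<alpha> * (1/2)"
      using start parameter_order(1-3) by (auto intro!: mult_strict_left_mono)
    then show ?thesis unfolding states_def lattice_window_def by (simp add: g)
  qed
  define ex where "ex j k = (if even k then px j else py j)" for j k :: nat
  define ey where "ey j k = (if even k then py j else px j)" for j k :: nat
  have at: "at_state (s k) (ex k k) (ey k k) (ex (Suc k) k - ex k k) (ey (Suc k) k - ey k k)" for k
  proof (induction k)
    case 0
    show ?case
      unfolding at_state_def s_def ex_def ey_def using g start c
      by (auto intro!: exI[of _ c])
  next
    case (Suc k)
    have "bounce (ex (Suc k) k) (ey (Suc k) k) (ex (Suc k) k - ex k k) (ey (Suc k) k - ey k k)
       (ey (Suc (Suc k)) (Suc k) - ey (Suc k) (Suc k)) (ex (Suc (Suc k)) (Suc k) - ex (Suc k) (Suc k))"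
      using b[of k] bounce_swap[OF b[of k]] by (auto simp: ex_def ey_def)
    from at_state_step(1)[OF Suc, simplified, OF this]
    show ?case by (cases "even k") (simp_all add: s_def ex_def ey_def)
  qed
  have exit: "\<exists>a' b' \<delta>'. exits (xcoeff (snd (s k))) (ycoeff (snd (s k))) (g - fst (s k)) (ex (Suc k) k) (ey (Suc k) k) a' b' \<delta>'" for k
  proof -
    have "bounce (ex (Suc k) k) (ey (Suc k) k) (ex (Suc k) k - ex k k) (ey (Suc k) k - ey k k)
       (ey (Suc (Suc k)) (Suc k) - ey (Suc k) (Suc k)) (ex (Suc (Suc k)) (Suc k) - ex (Suc k) (Suc k))"
      using b[of k] bounce_swap[OF b[of k]] by (auto simp: ex_def ey_def)
    from at_state_step(2)[OF at, simplified, OF this]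
    show ?thesis by simp
  qed
  show "px (m + k) = px k \<and> py (m + k) = py k" if m: "even m" "card states dvd m" and "0 < k"
  proof -
    from \<open>0 < k\<close> obtain j where k: "k = Suc j" by (cases k) auto
    have "s (m + j) = s j"
      using m returns_after_card[OF s0, of m] by (simp add: s_def funpow_add add.commute[of m])
    then have "ex (Suc (m + j)) (m + j) = ex (Suc j) j \<and> ey (Suc (m + j)) (m + j) = ey (Suc j) j"
      using exit[of "m + j"] exit[of j] exits_unique by metis
    then show "px (m + k) = px k \<and> py (m + k) = py k"
      using m by (auto simp: ex_def ey_def k split: if_splits)
  qed
  assume m: "px m = px 0" "py m = py 0" "px (Suc m) = px 1" "py (Suc m) = py 1"
  obtain n r where nr: "s m = (n, r)" by (cases "s m")
  obtain t :: real where t: "t > 0" "ex (Suc m) m - ex m m = t * ycoeff r" "ey (Suc m) m - ey m m = - t * xcoeff r"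
    and d: "xcoeff r * ex m m + ycoeff r * ey m m = g - n"
    using at[of m] by (auto simp: at_state_def nr)
  have "even m \<and> r = K0"
  proof -
    have eqs: "(if even m then - c * \<beta> else c * \<alpha>) = t * ycoeff r"
      "(if even m then c * \<alpha> else - c * \<beta>) = - t * xcoeff r"
      using t(2,3) c(2,3) m by (auto simp: ex_def ey_def)
    show ?thesis
    proof (cases "even m")
      case True
      have "0 < c * \<beta>" "0 < c * \<alpha>" using c(1) parameter_order(1-3) by auto
      then have "t * ycoeff r < 0" "t * xcoeff r < 0" using eqs True by simp_all
      then have sg: "ycoeff r < 0" "xcoeff r < 0" using t(1) by (simp_all add: mult_less_0_iff)
      have e: "t * ycoeff r = - (c * \<beta>)" "t * xcoeff r = - (c * \<alpha>)" using eqs True by simp_all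
      have "c * t * (\<beta> * xcoeff r) = (c * \<beta>) * (t * xcoeff r)" by (simp only: of_int_mult mult_ac)
      also have "\<dots> = (c * \<alpha>) * (t * ycoeff r)" unfolding e by (simp only: of_int_mult mult_ac minus_mult_right[symmetric])
      also have "\<dots> = c * t * (\<alpha> * ycoeff r)" by (simp only: of_int_mult mult_ac)
      finally have "c * t * (\<beta> * xcoeff r) = c * t * (\<alpha> * ycoeff r)" .
      then have "\<beta> * xcoeff r = \<alpha> * ycoeff r" using c(1) t(1) by (simp flip: of_int_mult)
      moreover have "\<beta> * \<gamma> < \<alpha> * \<alpha>" using beta_pos beta_less by (intro mult_strict_mono) (auto simp: \<alpha>_def)
      moreover have "0 < \<alpha>" using beta_pos beta_less by (simp add: \<alpha>_def)
      ultimately show ?thesis using sg True beta_pos beta_less by (cases r) auto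
    next
      case False
      have "0 < c * \<beta>" "0 < c * \<alpha>" using c(1) parameter_order(1-3) by auto
      then have "0 < t * ycoeff r" "0 < t * xcoeff r" using eqs False by simp_all
      then have sg: "0 < ycoeff r" "0 < xcoeff r" using t(1) by (simp_all add: zero_less_mult_iff)
      have e: "t * ycoeff r = c * \<alpha>" "t * xcoeff r = c * \<beta>" using eqs False by simp_all
      have "c * t * (\<alpha> * xcoeff r) = (c * \<alpha>) * (t * xcoeff r)" by (simp only: of_int_mult mult_ac)
      also have "\<dots> = (c * \<beta>) * (t * ycoeff r)" unfolding e by (simp only: of_int_mult mult_ac)
      also have "\<dots> = c * t * (\<beta> * ycoeff r)" by (simp only: of_int_mult mult_ac)
      finally have "c * t * (\<alpha> * xcoeff r) = c * t * (\<beta> * ycoeff r)" .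
      then have "\<alpha> * xcoeff r = \<beta> * ycoeff r" using c(1) t(1) by (simp flip: of_int_mult)
      moreover have "\<beta> * \<beta> < \<alpha> * \<alpha>" using beta_pos beta_less by (intro mult_strict_mono) (auto simp: \<alpha>_def)
      moreover have "\<beta> * \<alpha> < \<alpha> * \<gamma>" using beta_pos beta_less by (simp add: \<alpha>_def mult.commute)
      moreover have "0 < \<alpha>" using beta_pos beta_less by (simp add: \<alpha>_def)
      ultimately show ?thesis using sg beta_pos beta_less by (cases r) (auto simp: mult.commute)
    qed
  qed
  moreover have "n = 0"
    using d calculation m g start by (auto simp: ex_def ey_def)
  ultimately show "even m \<and> card states dvd m"
    using nr returns_after_card[OF s0, of m] by (simp add: s_def)
qed

end

text \<open>The return times are the positive multiples of \<open>lcm 2 (card states)\<close>. The starting point is not known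
to be the exit point of a tile, so its return is obtained by running once through the given period.\<close>

lemma (in kite_frame) orbit_period_card_states:
  fixes \<beta> \<gamma> :: int and c :: real
  assumes flow: "kite_flow \<beta> \<gamma>"
    and per: "periodic_orbit [A, M, B, D] p" and start: "p 0 \<in> open_segment A M"
    and c: "0 < c" "xlin (p 1 - p 0) = - c * \<beta>" "ylin (p 1 - p 0) = c * (\<beta> + \<gamma>)"
  obtains N :: nat and W :: int where "orbit_period p = (if even N then N else 2 * N)"
    "int N = 2 * (\<beta> + \<gamma>) + W" "\<bar>3 * W - 2 * (\<beta> + 2 * \<gamma>)\<bar> < 3"
proof -
  interpret kite_flow \<beta> \<gamma> "- (\<beta> + \<gamma>) * xcoord (p 0)" by (rule flow)
  have ns: "nonsingular_orbit [A, M, B, D] p" using per by (simp add: periodic_orbit_def)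
  obtain n\<^sub>0 where n0: "retraces_after p n\<^sub>0" using per by (auto simp: periodic_orbit_def)
  note st = open_edge_coord(1)[OF start]
  have g: "- (\<beta> + \<gamma>) * xcoord (p 0) = - \<alpha> * xcoord (p 0)" by (simp add: \<alpha>_def)
  have d: "xcoord (p 1) - xcoord (p 0) = - c * \<beta>" "ycoord (p 1) - ycoord (p 0) = c * \<alpha>"
    using c by (simp_all add: coord_diff \<alpha>_def)
  note ret = orbit_returns_iff[of "\<lambda>k. xcoord (p k)" "\<lambda>k. ycoord (p k)", OF g _ _ _ c(1) d orbit_bounce[OF ns]]
  have coord_eq: "a = b \<longleftrightarrow> xcoord a = xcoord b \<and> ycoord a = ycoord b" for a b
    by (metis pt_coord)
  let ?L = "lcm 2 (card states)"
  have iff: "retraces_after p m \<longleftrightarrow> 0 < m \<and> ?L dvd m" for m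
  proof
    assume m: "retraces_after p m"
    then have "p (m + 0) = p 0" "p (m + 1) = p 1" unfolding retraces_after_def by blast+
    then show "0 < m \<and> ?L dvd m" using ret(2)[of m] st m by (auto simp: retraces_after_def)
  next
    assume m: "0 < m \<and> ?L dvd m"
    then have "even m" "card states dvd m" by auto
    then have pos: "p (m + k) = p k" if "0 < k" for k
      using ret(1)[of m k] st that by (auto simp: coord_eq)
    have "p m = p (n\<^sub>0 + m)" using n0 by (simp add: retraces_after_def)
    also have "\<dots> = p n\<^sub>0" using pos[of n\<^sub>0] n0 by (simp add: retraces_after_def add.commute)
    also have "\<dots> = p 0" using n0 unfolding retraces_after_def by (metis add_0_right)
    finally have "p (m + k) = p k" for k using pos by (cases "k = 0") auto
    then show "retraces_after p m" using m by (simp add: retraces_after_def)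
  qed
  have "0 < ?L" using iff[of n\<^sub>0] n0 by (auto intro: gr0I)
  then have "orbit_period p = ?L"
    unfolding orbit_period_def iff
    by (intro Least_equality conjI dvd_refl) (blast intro: dvd_imp_le)+
  also have "\<dots> = (if even (card states) then card states else 2 * card states)"
  proof (cases "even (card states)")
    case False
    then have "coprime 2 (card states)" by simp
    then show ?thesis using False by (simp add: lcm_coprime)
  qed (simp add: lcm_proj2_if_dvd)
  finally show thesis
    using that[of "card states" width] card_states width_bounds by (simp add: \<alpha>_def)
qed

section \<open>Period formulas\<close>

text \<open>Primitivity of the lattice vector. If \<open>x\<close> and \<open>y\<close> are both odd, then \<open>(x, y sqrt 3)\<close> is twice a lattice
vector; otherwise it is itself primitive.\<close>

lemma coprime_half_sum_diff:
  fixes x y \<beta> \<gamma> :: int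
  assumes "coprime x y" and "\<gamma> - \<beta> = x \<and> \<gamma> + \<beta> = y \<or> odd (x + y) \<and> \<beta> = y - x \<and> \<gamma> = x + y"
  shows "coprime \<beta> \<gamma>"
proof (rule coprimeI)
  fix d assume d: "d dvd \<beta>" "d dvd \<gamma>"
  then have sd: "d dvd \<gamma> - \<beta>" "d dvd \<gamma> + \<beta>" by auto
  have "d dvd x \<and> d dvd y"
    using assms(2)
  proof (elim disjE conjE)
    assume h: "odd (x + y)" "\<beta> = y - x" "\<gamma> = x + y"
    have "odd d" using d h by (metis dvd_trans)
    then have "coprime d 2" by simp
    moreover have "d dvd 2 * x" "d dvd 2 * y" using sd h by (simp_all add: algebra_simps)
    ultimately show ?thesis by (simp add: coprime_dvd_mult_right_iff)
  qed (use sd in auto)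
  then show "is_unit d" using assms(1) by (meson coprime_common_divisor)
qed

text \<open>Here \<open>V\<close> is \<open>d x / 3\<close>, rounded down or up, and \<open>d\<close> is \<open>1\<close> if \<open>(x, y sqrt 3)\<close> is twice a lattice vector and
\<open>2\<close> otherwise. Unless \<open>3\<close> divides \<open>x\<close>, one rounding makes \<open>N\<close> even and the other makes it odd; the latter
doubles the period.\<close>

lemma period_formulas:
  fixes x y N m :: nat and V d :: int
  assumes N: "int N = 3 * d * int y + V" and V: "\<bar>3 * V - d * int x\<bar> < 3"
    and m: "m = (if even N then N else 2 * N)"
    and d: "odd x \<and> odd y \<and> d = 1 \<or> d = 2"
  shows "x mod 3 = 0 \<Longrightarrow> real m = 3 * d * real y + d * real x / 3"
    and "x mod 3 = 1 \<Longrightarrow> d = 1 \<Longrightarrow> real m = 3 * real y + (real x + 2) / 3 \<or> real m = 6 * real y + (2 * real x - 2) / 3"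
    and "x mod 3 = 2 \<Longrightarrow> d = 1 \<Longrightarrow> real m = 3 * real y + (real x - 2) / 3 \<or> real m = 6 * real y + (2 * real x + 2) / 3"
    and "x mod 3 = 1 \<Longrightarrow> d = 2 \<Longrightarrow> real m = 6 * real y + (2 * real x - 2) / 3 \<or> real m = 12 * real y + (4 * real x + 2) / 3"
    and "x mod 3 = 2 \<Longrightarrow> d = 2 \<Longrightarrow> real m = 6 * real y + (2 * real x + 2) / 3 \<or> real m = 12 * real y + (4 * real x - 2) / 3"
proof -
  have RN: "real N = 3 * real_of_int d * real y + real_of_int V"
    using arg_cong[OF N, of real_of_int] by simp
  have even: "even N \<longleftrightarrow> (even d \<or> even y \<longleftrightarrow> even V)"
    using arg_cong[OF N, of even] by auto
  have m: "even N \<Longrightarrow> real m = 3 * real_of_int d * real y + real_of_int V"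
    "odd N \<Longrightarrow> real m = 6 * real_of_int d * real y + 2 * real_of_int V"
    using m RN by auto
  have eq: "real_of_int V = (real_of_int d * real x + real_of_int i) / 3" if "3 * V = d * int x + i" for i
    using arg_cong[OF that, of real_of_int] by simp
  show "real m = 3 * d * real y + d * real x / 3" if x: "x mod 3 = 0"
  proof -
    have V': "3 * V = d * int x + 0" using V x d by (elim disjE conjE; simp; presburger)
    have "even N" unfolding even using V' d by (elim disjE conjE; simp; presburger)
    then show ?thesis using m(1) eq[OF V'] by simp
  qed
  show "real m = 3 * real y + (real x + 2) / 3 \<or> real m = 6 * real y + (2 * real x - 2) / 3"
    if x: "x mod 3 = 1" and d1: "d = 1"
  proof -
    consider (a) "3 * V = d * int x + 2" | (b) "3 * V = d * int x + (- 1)"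
      using V x unfolding d1 by atomize_elim presburger
    then show ?thesis
    proof cases
      case a
      then have "even N" unfolding even using d d1 by (simp; presburger)
      then show ?thesis using m(1) eq[OF a] d1 by simp
    next
      case b
      then have "odd N" unfolding even using d d1 by (simp; presburger)
      then show ?thesis using m(2) eq[OF b] d1 by (simp add: field_simps)
    qed
  qed
  show "real m = 3 * real y + (real x - 2) / 3 \<or> real m = 6 * real y + (2 * real x + 2) / 3"
    if x: "x mod 3 = 2" and d1: "d = 1"
  proof -
    consider (a) "3 * V = d * int x + (- 2)" | (b) "3 * V = d * int x + 1"
      using V x unfolding d1 by atomize_elim presburger
    then show ?thesis
    proof cases
      case a
      then have "even N" unfolding even using d d1 by (simp; presburger)
      then show ?thesis using m(1) eq[OF a] d1 by simp
    next
      case b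
      then have "odd N" unfolding even using d d1 by (simp; presburger)
      then show ?thesis using m(2) eq[OF b] d1 by (simp add: field_simps)
    qed
  qed
  show "real m = 6 * real y + (2 * real x - 2) / 3 \<or> real m = 12 * real y + (4 * real x + 2) / 3"
    if x: "x mod 3 = 1" and d2: "d = 2"
  proof -
    consider (a) "3 * V = d * int x + (- 2)" | (b) "3 * V = d * int x + 1"
      using V x unfolding d2 by atomize_elim presburger
    then show ?thesis
    proof cases
      case a
      then have "even N" unfolding even using d2 by (simp; presburger)
      then show ?thesis using m(1) eq[OF a] d2 by simp
    next
      case b
      then have "odd N" unfolding even using d2 by (simp; presburger)
      then show ?thesis using m(2) eq[OF b] d2 by (simp add: field_simps)
    qed
  qed
  show "real m = 6 * real y + (2 * real x + 2) / 3 \<or> real m = 12 * real y + (4 * real x - 2) / 3"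
    if x: "x mod 3 = 2" and d2: "d = 2"
  proof -
    consider (a) "3 * V = d * int x + 2" | (b) "3 * V = d * int x + (- 1)"
      using V x unfolding d2 by atomize_elim presburger
    then show ?thesis
    proof cases
      case a
      then have "even N" unfolding even using d2 by (simp; presburger)
      then show ?thesis using m(1) eq[OF a] d2 by simp
    next
      case b
      then have "odd N" unfolding even using d2 by (simp; presburger)
      then show ?thesis using m(2) eq[OF b] d2 by (simp add: field_simps)
    qed
  qed
qed

theorem mainTheorem3:
  fixes x y :: nat
    and A M B D P :: complex
    and p :: "nat \<Rightarrow> complex"
  assumes "0 < x" and "0 < y" and "x < y" and "gcd x y = 1"
    and "kite_60_90_120 A M B D"
    and "P \<in> open_segment A M"
    and "periodic_orbit [A, M, B, D] p" and "p 0 = P"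
    and "angle_between (M - P) (p 1 - P) = arctan (real y / real x * sqrt 3)"
  shows
    "([x = 0] (mod 3) \<and> [x = y] (mod 2) \<longrightarrow>
        real (orbit_period p) = 3 * real y + real x / 3) \<and>
     ([x = 0] (mod 3) \<and> \<not> [x = y] (mod 2) \<longrightarrow>
        real (orbit_period p) = 6 * real y + 2 * real x / 3) \<and>
     ([x = 1] (mod 3) \<and> [x = y] (mod 2) \<longrightarrow>
        real (orbit_period p) = 3 * real y + (real x + 2) / 3 \<or>
        real (orbit_period p) = 6 * real y + (2 * real x - 2) / 3) \<and>
     ([x = 1] (mod 3) \<and> \<not> [x = y] (mod 2) \<longrightarrow>
        real (orbit_period p) = 6 * real y + (2 * real x - 2) / 3 \<or>
        real (orbit_period p) = 12 * real y + (4 * real x + 2) / 3) \<and>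
     ([x = 2] (mod 3) \<and> [x = y] (mod 2) \<longrightarrow>
        real (orbit_period p) = 3 * real y + (real x - 2) / 3 \<or>
        real (orbit_period p) = 6 * real y + (2 * real x + 2) / 3) \<and>
     ([x = 2] (mod 3) \<and> \<not> [x = y] (mod 2) \<longrightarrow>
        real (orbit_period p) = 6 * real y + (2 * real x + 2) / 3 \<or>
        real (orbit_period p) = 12 * real y + (4 * real x - 2) / 3)"
proof -
  obtain l where l: "0 < l" and MBD: "M = kite_frame.pt A l (1/2) 0"
    "B = kite_frame.pt A l (1/3) (1/3)" "D = kite_frame.pt A l 0 (1/2)"
    using kite_frame_exists[OF assms(5)] .
  interpret kite_frame A l using l by unfold_locales
  note asm = assms(6-9)[unfolded MBD]
  have ns: "nonsingular_orbit [A, pt (1/2) 0, pt (1/3) (1/3), pt 0 (1/2)] p"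
    using asm(2) by (simp add: periodic_orbit_def)
  have st: "ycoord P = 0" "0 < xcoord P" "xcoord P < 1/2"
    using open_edge_coord(1)[OF asm(1)] by auto
  have ne: "p (Suc 0) \<noteq> p 0"
    and leg: "open_segment (p 0) (p (Suc 0)) \<subseteq> polygon_interior [A, pt (1/2) 0, pt (1/3) (1/3), pt 0 (1/2)]"
    using ns unfolding nonsingular_orbit_def by blast+
  have "0 < ycoord (p 1) - ycoord P"
    using leg_ends(5)[OF orbit_in_hull[OF ns] orbit_in_hull[OF ns] ne leg] st asm(3) by simp
  then have up: "0 < ylin (p 1 - P)" by (simp add: coord_diff)
  have P: "P = pt (xcoord P) 0" using pt_coord[of P] st by simp
  have MP: "pt (1/2) 0 - P = complex_of_real (l * (1/2 - xcoord P))"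
    by (subst P) (simp add: pt_def complex_eq_iff algebra_simps)
  have "0 < l * (1/2 - xcoord P)" using l st by simp
  then obtain c where c: "0 < c" "xlin (p 1 - P) = c * (real x - real y)" "ylin (p 1 - P) = c * (2 * real y)"
    using initial_direction[of "real x" "real y" "l * (1/2 - xcoord P)" "p 1 - P"]
      asm(4)[unfolded MP] assms(1,2) up by auto
  have cop: "coprime (int x) (int y)" using assms(4) by (simp add: coprime_iff_gcd_eq_1 gcd_int_int_eq)
  show ?thesis
  proof (cases "[x = y] (mod 2)")
    case True
    have "even x \<longleftrightarrow> even y" using True by (simp add: cong_def even_iff_mod_2_eq_zero)
    moreover have "\<not> (even x \<and> even y)" using assms(4) gcd_greatest[of 2 x y] by auto
    ultimately have "odd x" "odd y" by blast+
    define \<beta> where "\<beta> = (int y - int x) div 2"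
    define \<gamma> where "\<gamma> = (int x + int y) div 2"
    have bg: "2 * \<beta> = int y - int x" "2 * \<gamma> = int x + int y"
      using \<open>odd x\<close> \<open>odd y\<close> by (auto simp: \<beta>_def \<gamma>_def)
    have "coprime \<beta> \<gamma>"
      by (rule coprime_half_sum_diff[OF cop]) (use bg in auto)
    then have fl: "kite_flow \<beta> \<gamma>" using bg assms(1-3) by unfold_locales auto
    have rb: "real x = real_of_int (\<gamma> - \<beta>)" "real y = real_of_int (\<beta> + \<gamma>)"
      using arg_cong[OF bg(1), of real_of_int] arg_cong[OF bg(2), of real_of_int] by simp_all
    have dir: "xlin (p 1 - p 0) = - (2 * c) * \<beta>" "ylin (p 1 - p 0) = 2 * c * (\<beta> + \<gamma>)"
      unfolding asm(3) c(2,3) rb by (simp_all add: algebra_simps)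
    obtain N W where N: "orbit_period p = (if even N then N else 2 * N)"
      "int N = 2 * (\<beta> + \<gamma>) + W" "\<bar>3 * W - 2 * (\<beta> + 2 * \<gamma>)\<bar> < 3"
      using orbit_period_card_states[OF fl asm(2) _ _ dir] asm(1,3) c(1) by auto
    have N': "int N = 3 * 1 * int y + (W - int y)" "\<bar>3 * (W - int y) - 1 * int x\<bar> < 3"
      using N(2,3) bg by auto
    show ?thesis
      using True period_formulas[OF N' N(1)] \<open>odd x\<close> \<open>odd y\<close> by (simp add: cong_def)
  next
    case False
    then have odd: "odd (x + y)" unfolding cong_def by presburger
    define \<beta> where "\<beta> = int y - int x"
    define \<gamma> where "\<gamma> = int x + int y"
    have "coprime \<beta> \<gamma>"
      by (rule coprime_half_sum_diff[OF cop]) (use odd in \<open>auto simp: \<beta>_def \<gamma>_def\<close>)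
    then have fl: "kite_flow \<beta> \<gamma>" using assms(1-3) by unfold_locales (auto simp: \<beta>_def \<gamma>_def)
    have dir: "xlin (p 1 - p 0) = - c * \<beta>" "ylin (p 1 - p 0) = c * (\<beta> + \<gamma>)"
      unfolding asm(3) c(2,3) by (simp_all add: \<beta>_def \<gamma>_def algebra_simps)
    obtain N W where N: "orbit_period p = (if even N then N else 2 * N)"
      "int N = 2 * (\<beta> + \<gamma>) + W" "\<bar>3 * W - 2 * (\<beta> + 2 * \<gamma>)\<bar> < 3"
      using orbit_period_card_states[OF fl asm(2) _ _ dir] asm(1,3) c(1) by auto
    have N': "int N = 3 * 2 * int y + (W - 2 * int y)" "\<bar>3 * (W - 2 * int y) - 2 * int x\<bar> < 3"
      using N(2,3) by (auto simp: \<beta>_def \<gamma>_def)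
    show ?thesis
      using False period_formulas[OF N' N(1)] by (simp add: cong_def)
  qed
qed

end
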